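(* For each $n\ge 1$ let $X=X^{(n)}=(X_{ij})_{1\le i,j\le n}$ be a uniformly distributed $n\times n$ doubly stochastic matrix. Then for every $\epsilon>0$, \[ P\left(\max_{1\le i,j\le n} nX_{ij}>(2+\epsilon)\log n\right)\to 0\quad\text{as } n\to\infty . \]
   Context: A doubly stochastic matrix is an $n\times n$ matrix with nonnegative real entries all of whose row sums and column sums equal $1$; the set of these, the Birkhoff polytope, is an $(n-1)^2$-dimensional polytope. "Uniformly distributed" means distributed according to normalized $(n-1)^2$-dimensional Lebesgue measure on this polytope; equivalently, the entries $(X_{ij})_{1\le i,j\le n-1}$ are uniform (normalized Lebesgue measure on $\mathbb{R}^{(n-1)^2}$) on the set of $(n-1)\times(n-1)$ matrices that are the upper-left block of some doubly stochastic $n\times n$ matrix. *)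

theory Defs
  imports "HOL-Probability.Probability"
begin

text \<open>
  Matrices of variable size \<open>n\<close> are functions \<open>nat \<Rightarrow> nat \<Rightarrow> real\<close> of which only the entries with
  indices in \<open>{1..n}\<close> are meaningful.
\<close>

definition doubly_stochastic :: "nat \<Rightarrow> (nat \<Rightarrow> nat \<Rightarrow> real) \<Rightarrow> bool" where
  "doubly_stochastic n A \<longleftrightarrow>
     (\<forall>i\<in>{1..n}. \<forall>j\<in>{1..n}. 0 \<le> A i j) \<and>
     (\<forall>i\<in>{1..n}. (\<Sum>j=1..n. A i j) = 1) \<and>
     (\<forall>j\<in>{1..n}. (\<Sum>i=1..n. A i j) = 1)"

text \<open>
  The upper-left \<open>(n-1) \<times> (n-1)\<close> block, as a point of the product space carrying
  \<open>(n-1)\<^sup>2\<close>-dimensional Lebesgue measure; functions in this space are \<^const>\<open>undefined\<close> outside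
  the index set.
\<close>

abbreviation block_index :: "nat \<Rightarrow> (nat \<times> nat) set" where
  "block_index n \<equiv> {1..<n} \<times> {1..<n}"

definition block :: "nat \<Rightarrow> (nat \<Rightarrow> nat \<Rightarrow> real) \<Rightarrow> nat \<times> nat \<Rightarrow> real" where
  "block n A = (\<lambda>(i, j)\<in>block_index n. A i j)"

definition block_lebesgue :: "nat \<Rightarrow> (nat \<times> nat \<Rightarrow> real) measure" where
  "block_lebesgue n = Pi\<^sub>M (block_index n) (\<lambda>_. lborel)"

definition birkhoff_blocks :: "nat \<Rightarrow> (nat \<times> nat \<Rightarrow> real) set" where
  "birkhoff_blocks n = block n ` {A. doubly_stochastic n A}"

definition uniform_doubly_stochastic ::
    "'a measure \<Rightarrow> nat \<Rightarrow> ('a \<Rightarrow> nat \<Rightarrow> nat \<Rightarrow> real) \<Rightarrow> bool" where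
  "uniform_doubly_stochastic M n X \<longleftrightarrow>
     prob_space M \<and>
     (\<forall>i\<in>{1..n}. \<forall>j\<in>{1..n}. (\<lambda>\<omega>. X \<omega> i j) \<in> borel_measurable M) \<and>
     (AE \<omega> in M. doubly_stochastic n (X \<omega>)) \<and>
     distr M (block_lebesgue n) (\<lambda>\<omega>. block n (X \<omega>)) =
       uniform_measure (block_lebesgue n) (birkhoff_blocks n)"

end

theory Submission
  imports Defs
begin

text \<open>
  The tail \<open>G t = P (X i j > t)\<close> of a single entry is log-concave, since it is a ratio of volumes of
  sections of a convex body (Brunn--Minkowski). As the entry is nonnegative, this gives
  \<open>G (l * t) \<ge> G t powr l\<close> for \<open>l\<close> in \<open>(0, 1)\<close>; integrating over \<open>l\<close> bounds the mean of the entry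
  from below by \<open>t * (1 - G t) / (- ln (G t))\<close>. The mean is \<open>1 / n\<close>, because exchanging two rows preserves
  the uniform distribution and columns sum to \<open>1\<close>. Hence \<open>G t \<le> exp (1 - n * t)\<close>, and a union bound
  over the \<open>n\<^sup>2\<close> entries with \<open>n * t = (2 + \<epsilon>) * ln n\<close> leaves \<open>exp 1 * n powr - \<epsilon>\<close>.
\<close>

section \<open>The Prekopa--Leindler inequality on the unit cube\<close>

text \<open>Brunn--Minkowski is used in the multiplicative form
  \<open>vol A powr (1 - l) * vol B powr l\<close> at most \<open>vol C\<close>, whose exponents do
  not depend on the dimension. As a statement about sets it does not pass through Fubini, because
  the volumes of the sections of a set form a function. The functional version does induct on the
  dimension, and sets return at the end as indicators. Everything is done inside the unit cube,
  which contains the polytope: the product measure is then a probability measure, and measurable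
  functions with values in \<open>{0..1}\<close> are integrable. Block coordinates make volume
  concrete but hide the symmetry of the polytope. The last row and column are affine functions of
  the block, so an exchange with row \<open>n\<close> is a genuine change of variables whose
  Jacobian has to be accounted for. The exponent \<open>1 - n * t\<close> comes from weakening
  \<open>(1 - G) / (- ln G)\<close> to \<open>1 / (1 - ln G)\<close>. This can be solved for
  \<open>G\<close> and costs only a factor \<open>exp 1\<close> against the tail of an exponential
  variable of mean \<open>1 / n\<close>.\<close>

definition unit_uniform :: "real measure" where
  "unit_uniform = uniform_measure lborel {0..1}"

interpretation unit_uniform: prob_space unit_uniform
  unfolding unit_uniform_def by (rule prob_space_uniform_measure) auto

lemma sets_unit_uniform [simp, measurable_cong]: "sets unit_uniform = sets borel"
  and space_unit_uniform [simp]: "space unit_uniform = UNIV"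
  by (simp_all add: unit_uniform_def)

lemma measure_unit_uniform:
  assumes "A \<in> sets borel"
  shows "measure unit_uniform A = measure lborel ({0..1} \<inter> A)"
  using assms by (simp add: unit_uniform_def)

lemma AE_unit_uniform: "AE s in unit_uniform. 0 < s \<and> s < 1"
  unfolding unit_uniform_def
proof (rule AE_uniform_measureI)
  show "AE x in lborel. x \<in> {0..1::real} \<longrightarrow> 0 < x \<and> x < 1"
    using AE_lborel_singleton[of "0::real"] AE_lborel_singleton[of "1::real"] by eventually_elim auto
qed auto

lemma unit_uniform_measure_less:
  assumes "0 \<le> (z::real)"
  shows "measure unit_uniform {s. s < z} = min z 1"
proof -
  have "{0..1} \<inter> {s. s < z} = (if z \<le> 1 then {0..<z} else {0..1})"
    by auto
  then show ?thesis
    using assms by (subst measure_unit_uniform) (auto simp: min_def)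
qed

text \<open>Fubini for the region under the graph of \<open>Z\<close>. The level \<open>s\<close>
  ranges over the unit interval only, hence the truncation at \<open>1\<close>.\<close>

lemma (in prob_space) layer_cake:
  assumes [measurable]: "Z \<in> borel_measurable M" and nn: "\<And>x. x \<in> space M \<Longrightarrow> 0 \<le> Z x"
  shows "(\<integral>s. prob {x \<in> space M. s < Z x} \<partial>unit_uniform) = (\<integral>x. min (Z x) 1 \<partial>M)"
proof -
  interpret P: pair_prob_space M unit_uniform ..
  let ?f = "\<lambda>x s. indicator {s. s < Z x} s :: real"
  have m: "case_prod ?f \<in> borel_measurable (M \<Otimes>\<^sub>M unit_uniform)"
    by measurable
  have "integrable (M \<Otimes>\<^sub>M unit_uniform) (case_prod ?f)"
    by (rule P.integrable_const_bound[where B=1]) (use m in \<open>auto simp: indicator_def\<close>)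
  then have "(\<integral>s. (\<integral>x. ?f x s \<partial>M) \<partial>unit_uniform) = (\<integral>x. (\<integral>s. ?f x s \<partial>unit_uniform) \<partial>M)"
    by (rule P.Fubini_integral)
  moreover have "(\<integral>x. ?f x s \<partial>M) = prob {x \<in> space M. s < Z x}" for s
  proof -
    have "(\<integral>x. ?f x s \<partial>M) = (\<integral>x. indicator {x \<in> space M. s < Z x} x \<partial>M)"
      by (rule Bochner_Integration.integral_cong) (auto simp: indicator_def)
    then show ?thesis
      by simp
  qed
  moreover have "(\<integral>x. (\<integral>s. ?f x s \<partial>unit_uniform) \<partial>M) = (\<integral>x. min (Z x) 1 \<partial>M)"
    by (rule Bochner_Integration.integral_cong) (auto simp: unit_uniform_measure_less nn)
  ultimately show ?thesis
    by simp
qed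

text \<open>The set is the copy of \<open>A\<close> scaled by \<open>c\<close> and moved by
  \<open>t\<close>, written as a preimage so that its measurability is immediate.\<close>

lemma measure_lborel_affine_vimage:
  fixes A :: "real set"
  assumes [measurable]: "A \<in> sets borel" and "c > 0"
  shows "measure lborel {u. (u - t) / c \<in> A} = c * measure lborel A"
proof -
  have "emeasure lborel {u. (u - t) / c \<in> A} = (\<integral>\<^sup>+u. indicator {u. (u - t) / c \<in> A} u \<partial>lborel)"
    by (subst nn_integral_indicator) auto
  also have "\<dots> = \<bar>c\<bar> * (\<integral>\<^sup>+u. indicator {u. (u - t) / c \<in> A} (t + c * u) \<partial>lborel)"
    by (rule nn_integral_real_affine) (use assms in auto)
  also have "(\<lambda>u. indicator {u. (u - t) / c \<in> A} (t + c * u)) = (indicator A :: real \<Rightarrow> ennreal)"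
    using \<open>c > 0\<close> by (auto simp: indicator_def fun_eq_iff)
  finally have e: "emeasure lborel {u. (u - t) / c \<in> A} = ennreal c * emeasure lborel A"
    using \<open>c > 0\<close> by simp
  show ?thesis
    unfolding measure_def e using \<open>c > 0\<close> by (simp add: enn2real_mult)
qed

lemma fmeasurable_lborel_unit:
  fixes A :: "real set"
  assumes "A \<in> sets borel" "A \<subseteq> {0..1}"
  shows "A \<in> fmeasurable lborel"
  by (rule fmeasurableI2[OF fmeasurable_compact[OF compact_Icc] assms(2)]) (simp add: assms(1))

text \<open>\<open>C\<close> is a superset of the Minkowski combination because the latter need not
  be Borel. Both sets must be nonempty: if \<open>B\<close> were empty, the last hypothesis would
  say nothing about \<open>C\<close>, whatever the measure of \<open>A\<close>.\<close>

lemma brunn_minkowski_unit: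
  fixes A B C :: "real set"
  assumes borel [measurable]: "A \<in> sets borel" "B \<in> sets borel" "C \<in> sets borel"
    and unit: "A \<subseteq> {0..1}" "B \<subseteq> {0..1}" "C \<subseteq> {0..1}" and ne: "A \<noteq> {}" "B \<noteq> {}"
    and l: "0 < l" "l < 1"
    and sum: "\<And>a b. a \<in> A \<Longrightarrow> b \<in> B \<Longrightarrow> (1 - l) * a + l * b \<in> C"
  shows "(1 - l) * measure lborel A + l * measure lborel B \<le> measure lborel C"
proof -
  \<comment> \<open>The scaled copies of \<open>A\<close> left of \<open>a\<close> and of \<open>B\<close> right of \<open>b\<close> meet only in \<open>(1 - l) * a + l * b\<close>;
    then let \<open>a\<close> tend to \<open>Sup A\<close> and \<open>b\<close> to \<open>Inf B\<close>.\<close>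
  have key: "(1 - l) * measure lborel (A \<inter> {..a}) + l * measure lborel (B \<inter> {b..}) \<le> measure lborel C"
    if ab: "a \<in> A" "b \<in> B" for a b
  proof -
    define A' where "A' = {u. (u - l * b) / (1 - l) \<in> A \<inter> {..a}}"
    define B' where "B' = {u. (u - (1 - l) * a) / l \<in> B \<inter> {b..}}"
    have sub: "A' \<subseteq> C" "B' \<subseteq> C"
    proof safe
      fix u assume "u \<in> A'"
      then have "(1 - l) * ((u - l * b) / (1 - l)) + l * b \<in> C"
        by (intro sum ab) (auto simp: A'_def)
      then show "u \<in> C" using l by simp
    next
      fix u assume "u \<in> B'"
      then have "(1 - l) * a + l * ((u - (1 - l) * a) / l) \<in> C"
        by (intro sum ab) (auto simp: B'_def)
      then show "u \<in> C" using l by simp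
    qed
    have [measurable]: "A' \<in> sets borel" "B' \<in> sets borel"
      unfolding A'_def B'_def by measurable
    have "measure lborel A' + measure lborel B' \<le> measure lborel C"
    proof -
      have "A' \<inter> B' \<subseteq> {(1 - l) * a + l * b}"
        using l by (auto simp: A'_def B'_def field_simps)
      then have "A' \<inter> B' \<in> null_sets lborel"
        by (rule null_sets_subset[rotated 2]) auto
      then have "measure lborel (A' \<inter> B') = 0"
        by (simp add: measure_def null_setsD1)
      moreover have "measure lborel (A' \<union> B') \<le> measure lborel C"
        using sub unit by (intro measure_mono_fmeasurable fmeasurable_lborel_unit) auto
      moreover have "measure lborel (A' \<union> B') =
          measure lborel A' + measure lborel B' - measure lborel (A' \<inter> B')"
        using sub unit by (intro measure_Un3 fmeasurable_lborel_unit) auto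
      ultimately show ?thesis by simp
    qed
    then show ?thesis
      using l unfolding A'_def B'_def by (simp add: measure_lborel_affine_vimage del: Int_iff)
  qed
  show ?thesis
  proof (rule field_le_epsilon)
    fix e :: real assume "e > 0"
    have bdd: "bdd_above A" "bdd_below B"
      using unit by (auto intro: bdd_above_mono bdd_below_mono)
    obtain a where a: "a \<in> A" "Sup A - e < a"
      using less_cSupD[OF ne(1), of "Sup A - e"] \<open>e > 0\<close> by auto
    obtain b where b: "b \<in> B" "b < Inf B + e"
      using cInf_lessD[OF ne(2), of "Inf B + e"] \<open>e > 0\<close> by auto
    have "measure lborel A \<le> measure lborel (A \<inter> {..a} \<union> {a..Sup A})"
      using bdd unit
      by (intro measure_mono_fmeasurable fmeasurable.Un fmeasurable_lborel_unit fmeasurable_compact)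
        (auto intro: cSup_upper)
    also have "\<dots> \<le> measure lborel (A \<inter> {..a}) + measure lborel {a..Sup A}"
      using unit by (intro measure_Un_le) auto
    also have "measure lborel {a..Sup A} \<le> e"
      using a bdd by (auto simp: cSup_upper)
    finally have 1: "measure lborel A \<le> measure lborel (A \<inter> {..a}) + e" by simp
    have "measure lborel B \<le> measure lborel (B \<inter> {b..} \<union> {Inf B..b})"
      using bdd unit
      by (intro measure_mono_fmeasurable fmeasurable.Un fmeasurable_lborel_unit fmeasurable_compact)
        (auto intro: cInf_lower)
    also have "\<dots> \<le> measure lborel (B \<inter> {b..}) + measure lborel {Inf B..b}"
      using unit by (intro measure_Un_le) auto
    also have "measure lborel {Inf B..b} \<le> e"
      using b bdd by (auto simp: cInf_lower)
    finally have 2: "measure lborel B \<le> measure lborel (B \<inter> {b..}) + e" by simp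
    have "(1 - l) * measure lborel A + l * measure lborel B
        \<le> (1 - l) * (measure lborel (A \<inter> {..a}) + e) + l * (measure lborel (B \<inter> {b..}) + e)"
      using l 1 2 by (intro add_mono mult_left_mono) auto
    also have "\<dots> = (1 - l) * measure lborel (A \<inter> {..a}) + l * measure lborel (B \<inter> {b..}) + e"
      by (simp add: algebra_simps)
    also have "\<dots> \<le> measure lborel C + e"
      using key[OF a(1) b(1)] by simp
    finally show "(1 - l) * measure lborel A + l * measure lborel B \<le> measure lborel C + e" .
  qed
qed

lemma weighted_am_gm:
  fixes a b l :: real
  assumes "0 \<le> a" "0 \<le> b" "0 < l" "l < 1"
  shows "a powr (1 - l) * b powr l \<le> (1 - l) * a + l * b"
proof (cases "a = 0 \<or> b = 0")
  case True
  then show ?thesis using assms by auto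
next
  case False
  then show ?thesis using assms by (intro Youngs_inequality_0) auto
qed

text \<open>The additive set inequality is integrated over the levels of the normalised functions;
  only the last step weakens the arithmetic mean of the integrals to a geometric one.\<close>

lemma prekopa_leindler_unit:
  fixes f g h :: "real \<Rightarrow> real"
  assumes meas [measurable]: "f \<in> borel_measurable borel" "g \<in> borel_measurable borel" "h \<in> borel_measurable borel"
    and range: "\<And>u. f u \<in> {0..1}" "\<And>u. g u \<in> {0..1}" "\<And>u. h u \<in> {0..1}"
    and l: "0 < l" "l < 1"
    and le: "\<And>u v. u \<in> {0..1} \<Longrightarrow> v \<in> {0..1} \<Longrightarrow>
        f u powr (1 - l) * g v powr l \<le> h ((1 - l) * u + l * v)"
  shows "(\<integral>u. f u \<partial>unit_uniform) powr (1 - l) * (\<integral>u. g u \<partial>unit_uniform) powr l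
      \<le> (\<integral>u. h u \<partial>unit_uniform)"
proof -
  \<comment> \<open>The suprema are taken over the unit interval only, since
    \<open>unit_uniform\<close> does not see the values elsewhere.\<close>
  define a where "a = Sup (f ` {0..1})"
  define b where "b = Sup (g ` {0..1})"
  have bdd: "bdd_above (f ` {0..1})" "bdd_above (g ` {0..1})"
    using range by (auto intro!: bdd_aboveI[of _ 1])
  have fa: "f u \<le> a" "g u \<le> b" if "u \<in> {0..1}" for u
    unfolding a_def b_def using bdd that by (auto intro: cSup_upper)
  have ab: "0 \<le> a" "0 \<le> b"
    using fa[of 0] range[of 0] by force+
  have int: "integrable unit_uniform f" "integrable unit_uniform g" "integrable unit_uniform h"
    using range by (auto intro!: unit_uniform.integrable_const_bound[where B=1])
  have AE01: "AE u in unit_uniform. u \<in> {0..1}"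
    using AE_unit_uniform by eventually_elim auto
  have h0: "0 \<le> (\<integral>u. h u \<partial>unit_uniform)"
    using range by (intro integral_nonneg_AE) auto
  consider "a = 0" | "b = 0" | "a > 0" "b > 0" using ab by fastforce
  then show ?thesis
  proof cases
    case 1
    have "AE u in unit_uniform. f u = 0"
      using AE01 by eventually_elim (use fa 1 range in \<open>force intro: antisym\<close>)
    then have "(\<integral>u. f u \<partial>unit_uniform) = 0"
      by (rule integral_eq_zero_AE)
    then show ?thesis using h0 by simp
  next
    case 2
    have "AE u in unit_uniform. g u = 0"
      using AE01 by eventually_elim (use fa 2 range in \<open>force intro: antisym\<close>)
    then have "(\<integral>u. g u \<partial>unit_uniform) = 0"
      by (rule integral_eq_zero_AE)
    then show ?thesis using h0 by simp
  next
    case 3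
    \<comment> \<open>After dividing by the suprema, every level set below \<open>1\<close> is nonempty, so the set inequality
      applies to each level.\<close>
    define c where "c = a powr (1 - l) * b powr l"
    have c: "c > 0" using 3 by (simp add: c_def)
    let ?F = "\<lambda>s. {u. s < f u / a}" and ?G = "\<lambda>s. {u. s < g u / b}" and ?H = "\<lambda>s. {u. s < h u / c}"
    have level: "(1 - l) * measure unit_uniform (?F s) + l * measure unit_uniform (?G s)
        \<le> measure unit_uniform (?H s)" if s: "0 \<le> s" "s < 1" for s
    proof -
      have "\<exists>u\<in>{0..1}. s * a < f u"
        using less_cSupD[of "f ` {0..1}" "s * a"] 3 s by (auto simp: a_def[symmetric])
      moreover have "\<exists>u\<in>{0..1}. s * b < g u"
        using less_cSupD[of "g ` {0..1}" "s * b"] 3 s by (auto simp: b_def[symmetric])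
      moreover have "s < h ((1 - l) * u + l * v) / c"
        if uv: "u \<in> {0..1}" "v \<in> {0..1}" "s < f u / a" "s < g v / b" for u v
      proof -
        \<comment> \<open>The exponents add up to \<open>1\<close>, so relative level
          \<open>s\<close> of both \<open>f\<close> and \<open>g\<close> corresponds to relative
          level \<open>s\<close> of \<open>h\<close> when \<open>h\<close> is divided by
          \<open>c\<close>.\<close>
        have "s * c = (s * a) powr (1 - l) * (s * b) powr l"
        proof (cases "s = 0")
          case False
          then have "s = s powr (1 - l) * s powr l"
            using s by (simp flip: powr_add)
          then show ?thesis
            using s 3 by (simp add: c_def powr_mult mult_ac)
        qed (use l in auto)
        also have "\<dots> < f u powr (1 - l) * g v powr l"
          using uv 3 s l by (intro mult_strict_mono' powr_less_mono2) (auto simp: field_simps)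
        also have "\<dots> \<le> h ((1 - l) * u + l * v)"
          by (rule le) (use uv in auto)
        finally show ?thesis
          using c by (simp add: field_simps)
      qed
      moreover have "(1 - l) * u + l * v \<in> {0..1}" if "u \<in> {0..1}" "v \<in> {0..1}" for u v
        using convexD[of "{0..1::real}" u v "1 - l" l] that l by auto
      ultimately show ?thesis
        using 3 l by (subst (1 2 3) measure_unit_uniform; (intro brunn_minkowski_unit)?)
          (auto simp: field_simps)
    qed
    have tail_integrable: "integrable unit_uniform (\<lambda>s. measure unit_uniform {u. s < Z u})"
      if [measurable]: "Z \<in> borel_measurable borel" for Z :: "real \<Rightarrow> real"
    proof (rule unit_uniform.integrable_const_bound[where B=1])
      \<comment> \<open>Measurability in \<open>s\<close> comes from monotonicity: the tail
        decreases, so its negative is increasing and hence Borel.\<close>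
      have "antimono (\<lambda>s. measure unit_uniform {u. s < Z u})"
        by (intro antimonoI unit_uniform.finite_measure_mono) auto
      then have "mono (\<lambda>s. - measure unit_uniform {u. s < Z u})"
        by (auto simp: antimono_def mono_def)
      then have "(\<lambda>s. - (- measure unit_uniform {u. s < Z u})) \<in> borel_measurable unit_uniform"
        by (intro borel_measurable_uminus) (simp add: borel_measurable_mono)
      then show "(\<lambda>s. measure unit_uniform {u. s < Z u}) \<in> borel_measurable unit_uniform"
        by simp
    qed auto
    have cake: "(\<integral>s. measure unit_uniform {u. s < Z u} \<partial>unit_uniform) = (\<integral>u. min (Z u) 1 \<partial>unit_uniform)"
      if "Z \<in> borel_measurable borel" "\<And>u. 0 \<le> Z u" for Z :: "real \<Rightarrow> real"
      using unit_uniform.layer_cake[of Z] that by simp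
    have sup_normalised: "(\<integral>u. min (Z u / d) 1 \<partial>unit_uniform) = (\<integral>u. Z u \<partial>unit_uniform) / d"
      if [measurable]: "Z \<in> borel_measurable borel" and "d > 0" "\<And>u. u \<in> {0..1} \<Longrightarrow> Z u \<le> d"
      for Z :: "real \<Rightarrow> real" and d
    proof -
      have "AE u in unit_uniform. min (Z u / d) 1 = Z u / d"
        using AE01 by eventually_elim (use that in \<open>auto simp: min_def field_simps\<close>)
      then have "(\<integral>u. min (Z u / d) 1 \<partial>unit_uniform) = (\<integral>u. Z u / d \<partial>unit_uniform)"
        by (intro integral_cong_AE) auto
      then show ?thesis by simp
    qed
    have f1: "(\<integral>u. min (f u / a) 1 \<partial>unit_uniform) = (\<integral>u. f u \<partial>unit_uniform) / a"
      and g1: "(\<integral>u. min (g u / b) 1 \<partial>unit_uniform) = (\<integral>u. g u \<partial>unit_uniform) / b"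
      using 3 fa by (auto intro: sup_normalised)
    \<comment> \<open>No supremum of \<open>h\<close> is involved here: \<open>h\<close> may exceed
      \<open>c\<close>, and truncating it at \<open>c\<close> lowers the integral, which is the
      direction required.\<close>
    have h1: "(\<integral>u. min (h u / c) 1 \<partial>unit_uniform) \<le> (\<integral>u. h u \<partial>unit_uniform) / c"
    proof -
      have "(\<integral>u. min (h u / c) 1 \<partial>unit_uniform) \<le> (\<integral>u. h u / c \<partial>unit_uniform)"
        using int c range
        by (intro integral_mono unit_uniform.integrable_const_bound[where B=1 and f="\<lambda>u. min (h u / c) 1"])
          auto
      then show ?thesis by simp
    qed
    have "(1 - l) * ((\<integral>u. f u \<partial>unit_uniform) / a) + l * ((\<integral>u. g u \<partial>unit_uniform) / b)
       = (\<integral>s. (1 - l) * measure unit_uniform (?F s) + l * measure unit_uniform (?G s) \<partial>unit_uniform)"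
      using 3 range by (simp add: tail_integrable cake f1 g1)
    also have "\<dots> \<le> (\<integral>s. measure unit_uniform (?H s) \<partial>unit_uniform)"
    proof (rule integral_mono_AE)
      show "AE s in unit_uniform. (1 - l) * measure unit_uniform (?F s) + l * measure unit_uniform (?G s)
          \<le> measure unit_uniform (?H s)"
        using AE_unit_uniform by eventually_elim (intro level; simp)
    qed (intro Bochner_Integration.integrable_add integrable_mult_right tail_integrable; measurable)+
    also have "\<dots> \<le> (\<integral>u. h u \<partial>unit_uniform) / c"
      using h1 c range by (simp add: cake)
    finally have *: "(1 - l) * ((\<integral>u. f u \<partial>unit_uniform) / a) + l * ((\<integral>u. g u \<partial>unit_uniform) / b)
        \<le> (\<integral>u. h u \<partial>unit_uniform) / c" .
    have nn: "0 \<le> (\<integral>u. f u \<partial>unit_uniform)" "0 \<le> (\<integral>u. g u \<partial>unit_uniform)"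
      using range by (auto intro!: integral_nonneg_AE)
    have "((\<integral>u. f u \<partial>unit_uniform) / a) powr (1 - l) * ((\<integral>u. g u \<partial>unit_uniform) / b) powr l
        \<le> (\<integral>u. h u \<partial>unit_uniform) / c"
      using weighted_am_gm[of "(\<integral>u. f u \<partial>unit_uniform) / a" "(\<integral>u. g u \<partial>unit_uniform) / b" l] * nn 3 l
      by simp
    moreover have "((\<integral>u. f u \<partial>unit_uniform) / a) powr (1 - l) * ((\<integral>u. g u \<partial>unit_uniform) / b) powr l
        = ((\<integral>u. f u \<partial>unit_uniform) powr (1 - l) * (\<integral>u. g u \<partial>unit_uniform) powr l) / c"
      using 3 nn by (simp add: powr_divide c_def)
    ultimately show ?thesis
      using c by (simp add: divide_le_cancel)
  qed
qed

section \<open>From the interval to the cube, and from functions to sets\<close>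

interpretation unit_cube: product_prob_space "\<lambda>_. unit_uniform" I for I ..

lemma (in prob_space) integrable_unit_valued:
  assumes "f \<in> borel_measurable M" "\<And>x. f x \<in> {0..1::real}"
  shows "integrable M f"
  by (rule integrable_const_bound[where B=1]) (use assms in auto)

text \<open>Induction on the number of coordinates. Integrating out one coordinate turns the
  pointwise hypothesis into the same hypothesis for the marginals, and this is exactly the
  one-dimensional inequality on the fibres.\<close>

lemma prekopa_leindler_cube:
  fixes f g h :: "('i \<Rightarrow> real) \<Rightarrow> real"
  assumes "finite I" and l: "0 < l" "l < 1"
    and "f \<in> borel_measurable (PiM I (\<lambda>_. unit_uniform))"
    and "g \<in> borel_measurable (PiM I (\<lambda>_. unit_uniform))"
    and "h \<in> borel_measurable (PiM I (\<lambda>_. unit_uniform))"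
    and "\<And>x. f x \<in> {0..1}" "\<And>x. g x \<in> {0..1}" "\<And>x. h x \<in> {0..1}"
    and "\<And>x y. x \<in> PiE I (\<lambda>_. {0..1}) \<Longrightarrow> y \<in> PiE I (\<lambda>_. {0..1}) \<Longrightarrow>
        f x powr (1 - l) * g y powr l \<le> h (\<lambda>i\<in>I. (1 - l) * x i + l * y i)"
  shows "(\<integral>x. f x \<partial>PiM I (\<lambda>_. unit_uniform)) powr (1 - l) * (\<integral>x. g x \<partial>PiM I (\<lambda>_. unit_uniform)) powr l
      \<le> (\<integral>x. h x \<partial>PiM I (\<lambda>_. unit_uniform))"
  using assms(1,4-)
proof (induction I arbitrary: f g h rule: finite_induct)
  case empty
  \<comment> \<open>The empty product is the point mass at \<open>\<lambda>_. undefined\<close>, so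
    the integrals are values at that point.\<close>
  show ?case
    using empty.prems(7)[of "\<lambda>_. undefined" "\<lambda>_. undefined"]
    by (simp add: PiM_empty lebesgue_integral_count_space_finite restrict_def)
next
  case (insert k I)
  let ?P = "PiM I (\<lambda>_. unit_uniform)" and ?P' = "PiM (insert k I) (\<lambda>_. unit_uniform)"
  have P': "prob_space ?P'" by (rule prob_space_PiM) unfold_locales
  note meas [measurable] = insert.prems(1-3)
  define S where "S \<phi> x = (\<integral>u. \<phi> (x(k := u)) \<partial>unit_uniform)" for \<phi> :: "('i \<Rightarrow> real) \<Rightarrow> real" and x
  have S_meas: "S \<phi> \<in> borel_measurable ?P" if [measurable]: "\<phi> \<in> borel_measurable ?P'" for \<phi>
    unfolding S_def by measurable
  have sect: "(\<lambda>u. \<phi> (x(k := u))) \<in> borel_measurable borel"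
    if [measurable]: "\<phi> \<in> borel_measurable ?P'" and x: "x \<in> space ?P" for \<phi> :: "('i \<Rightarrow> real) \<Rightarrow> real" and x
  proof -
    have "(\<lambda>u. x(k := u)) \<in> measurable unit_uniform ?P'"
      using x by (intro measurable_fun_upd[where J=I]) auto
    then have "(\<lambda>u. \<phi> (x(k := u))) \<in> borel_measurable unit_uniform"
      by measurable
    then show ?thesis by (simp cong: measurable_cong_sets)
  qed
  \<comment> \<open>This must hold for every \<open>x\<close>, even outside the space, where a
    section may fail to be integrable; its integral is then \<open>0\<close> by convention, which
    still lies in the unit interval.\<close>
  have S_range: "S \<phi> x \<in> {0..1}"
    if "\<And>x. \<phi> x \<in> {0..1}" for \<phi> x
  proof (cases "integrable unit_uniform (\<lambda>u. \<phi> (x(k := u)))")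
    case True
    then have "S \<phi> x \<le> (\<integral>u. 1 \<partial>unit_uniform)"
      unfolding S_def using that by (intro integral_mono) auto
    moreover have "0 \<le> S \<phi> x"
      unfolding S_def using that by (intro integral_nonneg_AE) auto
    ultimately show ?thesis by (simp add: unit_uniform.prob_space[simplified])
  qed (simp add: S_def not_integrable_integral_eq)
  have fubini: "(\<integral>x. \<phi> x \<partial>?P') = (\<integral>x. S \<phi> x \<partial>?P)"
    if [measurable]: "\<phi> \<in> borel_measurable ?P'" and "\<And>x. \<phi> x \<in> {0..1}" for \<phi>
    unfolding S_def using insert.hyps that
    by (intro unit_cube.product_integral_insert prob_space.integrable_unit_valued[OF P']) auto
  have "S f x powr (1 - l) * S g y powr l \<le> S h (\<lambda>i\<in>I. (1 - l) * x i + l * y i)"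
    if xy: "x \<in> PiE I (\<lambda>_. {0..1})" "y \<in> PiE I (\<lambda>_. {0..1})" for x y
    unfolding S_def
  proof (rule prekopa_leindler_unit)
    fix u v :: real assume uv: "u \<in> {0..1}" "v \<in> {0..1}"
    have "f (x(k := u)) powr (1 - l) * g (y(k := v)) powr l
        \<le> h (\<lambda>i\<in>insert k I. (1 - l) * (x(k := u)) i + l * (y(k := v)) i)"
      using xy uv by (intro insert.prems(7)) (auto simp: PiE_iff extensional_def)
    also have "(\<lambda>i\<in>insert k I. (1 - l) * (x(k := u)) i + l * (y(k := v)) i)
        = (\<lambda>i\<in>I. (1 - l) * x i + l * y i)(k := (1 - l) * u + l * v)"
      using \<open>k \<notin> I\<close> by (auto simp: fun_eq_iff)
    finally show "f (x(k := u)) powr (1 - l) * g (y(k := v)) powr l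
        \<le> h ((\<lambda>i\<in>I. (1 - l) * x i + l * y i)(k := (1 - l) * u + l * v))" .
  qed (use xy l insert.prems in \<open>auto intro!: sect simp: space_PiM PiE_iff\<close>)
  then have "(\<integral>x. S f x \<partial>?P) powr (1 - l) * (\<integral>x. S g x \<partial>?P) powr l \<le> (\<integral>x. S h x \<partial>?P)"
    by (intro insert.IH S_meas S_range insert.prems)
  then show ?case
    by (simp only: fubini[OF insert.prems(1,4)] fubini[OF insert.prems(2,5)] fubini[OF insert.prems(3,6)])
qed

text \<open>Product Lebesgue measure restricted to the cube agrees with the product of the
  \<open>unit_uniform\<close> measures on boxes, hence everywhere.\<close>

lemma emeasure_unit_cube:
  assumes "finite I" and A: "A \<in> sets (PiM I (\<lambda>_. lborel))" "A \<subseteq> PiE I (\<lambda>_. {0..1})"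
  shows "emeasure (PiM I (\<lambda>_. unit_uniform)) A = emeasure (PiM I (\<lambda>_. lborel :: real measure)) A"
proof -
  interpret L: product_sigma_finite "\<lambda>_. lborel :: real measure" ..
  let ?L = "PiM I (\<lambda>_. lborel :: real measure)" and ?Q = "PiE I (\<lambda>_. {0..1::real})"
  have Q: "?Q \<in> sets ?L"
    using \<open>finite I\<close> by (intro sets_PiM_I_finite) auto
  have sets: "sets (PiM I (\<lambda>_. unit_uniform)) = sets ?L"
    by (intro sets_PiM_cong) auto
  have "density ?L (indicator ?Q) = PiM I (\<lambda>_. unit_uniform)"
  proof (rule unit_cube.PiM_eqI[OF \<open>finite I\<close>])
    fix B :: "'a \<Rightarrow> real set" assume B: "\<And>i. i \<in> I \<Longrightarrow> B i \<in> sets unit_uniform"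
    have "emeasure (density ?L (indicator ?Q)) (PiE I B) = emeasure ?L (?Q \<inter> PiE I B)"
      using Q B \<open>finite I\<close> by (intro emeasure_restricted sets_PiM_I_finite) auto
    also have "?Q \<inter> PiE I B = PiE I (\<lambda>i. {0..1} \<inter> B i)"
      by (simp add: PiE_Int)
    also have "emeasure ?L \<dots> = (\<Prod>i\<in>I. emeasure lborel ({0..1} \<inter> B i))"
      using B \<open>finite I\<close> by (intro L.emeasure_PiM) auto
    also have "\<dots> = (\<Prod>i\<in>I. emeasure unit_uniform (B i))"
      using B by (intro prod.cong) (auto simp: unit_uniform_def divide_ennreal_def)
    finally show "emeasure (density ?L (indicator ?Q)) (PiE I B) = (\<Prod>i\<in>I. emeasure unit_uniform (B i))" .
  qed (simp add: sets)
  then have "emeasure (PiM I (\<lambda>_. unit_uniform)) A = emeasure ?L (?Q \<inter> A)"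
    using emeasure_restricted[OF Q A(1)] by simp
  then show ?thesis
    using A by (simp add: Int_absorb1)
qed

text \<open>Prekopa--Leindler for indicators. If \<open>A\<close> or \<open>B\<close> is empty the
  left side is \<open>0\<close>, so the nonemptiness required by the additive form
  disappears.\<close>

lemma brunn_minkowski_cube:
  fixes A B C :: "('i \<Rightarrow> real) set"
  assumes I: "finite I" and l: "0 < l" "l < 1"
    and sets: "A \<in> sets (PiM I (\<lambda>_. lborel))" "B \<in> sets (PiM I (\<lambda>_. lborel))" "C \<in> sets (PiM I (\<lambda>_. lborel))"
    and cube: "A \<subseteq> PiE I (\<lambda>_. {0..1})" "B \<subseteq> PiE I (\<lambda>_. {0..1})" "C \<subseteq> PiE I (\<lambda>_. {0..1})"
    and sum: "\<And>x y. x \<in> A \<Longrightarrow> y \<in> B \<Longrightarrow> (\<lambda>i\<in>I. (1 - l) * x i + l * y i) \<in> C"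
  shows "measure (PiM I (\<lambda>_. lborel)) A powr (1 - l) * measure (PiM I (\<lambda>_. lborel)) B powr l
    \<le> measure (PiM I (\<lambda>_. lborel)) C"
proof -
  have s: "sets (PiM I (\<lambda>_. unit_uniform)) = sets (PiM I (\<lambda>_. lborel :: real measure))"
    by (intro sets_PiM_cong) auto
  have ind: "indicator X \<in> borel_measurable (PiM I (\<lambda>_. unit_uniform))"
    if "X \<in> sets (PiM I (\<lambda>_. lborel))" for X :: "('i \<Rightarrow> real) set"
    using that s by (intro borel_measurable_indicator) simp
  have int: "(\<integral>x. indicator X x \<partial>PiM I (\<lambda>_. unit_uniform)) = measure (PiM I (\<lambda>_. lborel)) X"
    if "X \<in> sets (PiM I (\<lambda>_. lborel))" "X \<subseteq> PiE I (\<lambda>_. {0..1})" for X :: "('i \<Rightarrow> real) set"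
  proof -
    have "X \<subseteq> space (PiM I (\<lambda>_. unit_uniform))"
      using that(2) by (auto simp: space_PiM PiE_iff)
    then show ?thesis
      using emeasure_unit_cube[OF I that] by (simp add: measure_def Int_absorb2)
  qed
  show ?thesis
    unfolding int[OF sets(1) cube(1), symmetric] int[OF sets(2) cube(2), symmetric] int[OF sets(3) cube(3), symmetric]
    by (rule prekopa_leindler_cube[OF I l ind[OF sets(1)] ind[OF sets(2)] ind[OF sets(3)]])
      (use sum in \<open>auto simp: indicator_def\<close>)
qed

section \<open>Reflections and shears of product Lebesgue measure\<close>

lemma PiM_lborel_reflect:
  fixes c :: "'i \<Rightarrow> real"
  assumes "finite J"
  shows "distr (PiM J (\<lambda>_. lborel)) (PiM J (\<lambda>_. lborel)) (\<lambda>y. \<lambda>k\<in>J. c k - y k) = PiM J (\<lambda>_. lborel)"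
proof -
  interpret L: product_sigma_finite "\<lambda>_::'i. lborel :: real measure" ..
  have meas: "(\<lambda>y. \<lambda>k\<in>J. c k - y k) \<in> measurable (PiM J (\<lambda>_. lborel)) (PiM J (\<lambda>_. lborel))"
    by (intro measurable_restrict) simp
  show ?thesis
  proof (rule L.PiM_eqI[OF assms])
    fix A :: "'i \<Rightarrow> real set" assume A: "\<And>k. k \<in> J \<Longrightarrow> A k \<in> sets lborel"
    have A' [measurable]: "(\<lambda>u. c k - u) -` A k \<in> sets borel" if "k \<in> J" for k
      using A[OF that] measurable_sets[of "\<lambda>u. c k - u" borel borel "A k"] by simp
    have "emeasure (distr (PiM J (\<lambda>_. lborel)) (PiM J (\<lambda>_. lborel)) (\<lambda>y. \<lambda>k\<in>J. c k - y k)) (PiE J A)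
       = emeasure (PiM J (\<lambda>_. lborel)) (PiE J (\<lambda>k. (\<lambda>u. c k - u) -` A k))"
      using A assms by (subst emeasure_distr[OF meas])
        (auto simp: space_PiM PiE_iff intro!: sets_PiM_I_finite arg_cong[where f="emeasure _"])
    also have "\<dots> = (\<Prod>k\<in>J. emeasure lborel ((\<lambda>u. c k - u) -` A k))"
      using A' by (intro L.emeasure_PiM assms) auto
    also have "\<dots> = (\<Prod>k\<in>J. emeasure lborel (A k))"
    proof (intro prod.cong refl)
      fix k assume k: "k \<in> J"
      have "lborel = distr (distr lborel borel uminus) borel ((+) (c k))"
        by (simp add: lborel_distr_uminus lborel_distr_plus)
      also have "\<dots> = distr lborel borel (\<lambda>u. c k - u)"
        by (subst distr_distr) (auto simp: o_def)
      finally have "emeasure lborel (A k) = emeasure (distr lborel borel (\<lambda>u. c k - u)) (A k)"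
        by simp
      then show "emeasure lborel ((\<lambda>u. c k - u) -` A k) = emeasure lborel (A k)"
        using A[OF k] by (simp add: emeasure_distr)
    qed
    finally show "emeasure (distr (PiM J (\<lambda>_. lborel)) (PiM J (\<lambda>_. lborel)) (\<lambda>y. \<lambda>k\<in>J. c k - y k)) (PiE J A)
       = (\<Prod>k\<in>J. emeasure lborel (A k))" .
  qed simp
qed

text \<open>By Fubini with the coordinates in \<open>J\<close> innermost: once the others are fixed,
  \<open>indep\<close> makes every \<open>c k\<close> a constant, and the inner map is a
  coordinatewise reflection.\<close>

lemma nn_integral_PiM_lborel_shear_reflect:
  fixes c :: "'i \<Rightarrow> ('i \<Rightarrow> real) \<Rightarrow> real" and f :: "('i \<Rightarrow> real) \<Rightarrow> ennreal"
  assumes "finite I" "J \<subseteq> I"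
    and c [measurable]: "\<And>k. k \<in> J \<Longrightarrow> c k \<in> borel_measurable (PiM I (\<lambda>_. lborel))"
    and indep: "\<And>k x y. k \<in> J \<Longrightarrow> (\<And>i. i \<in> I - J \<Longrightarrow> x i = y i) \<Longrightarrow> c k x = c k y"
    and f [measurable]: "f \<in> borel_measurable (PiM I (\<lambda>_. lborel))"
  shows "(\<integral>\<^sup>+x. f (\<lambda>k\<in>I. if k \<in> J then c k x - x k else x k) \<partial>PiM I (\<lambda>_. lborel))
    = (\<integral>\<^sup>+x. f x \<partial>PiM I (\<lambda>_. lborel))"
proof -
  interpret L: product_sigma_finite "\<lambda>_::'i. lborel :: real measure" ..
  let ?T = "\<lambda>x. \<lambda>k\<in>I. if k \<in> J then c k x - x k else x k"
  let ?D = "I - J"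
  have IJ: "?D \<union> J = I" and fin: "finite ?D" "finite J" and disj: "?D \<inter> J = {}"
    using assms finite_subset by auto
  have T: "?T \<in> measurable (PiM I (\<lambda>_. lborel)) (PiM I (\<lambda>_. lborel))"
  proof (rule measurable_restrict)
    fix k assume k: "k \<in> I"
    then show "(\<lambda>x. if k \<in> J then c k x - x k else x k) \<in> measurable (PiM I (\<lambda>_. lborel)) lborel"
      by (cases "k \<in> J") (auto intro!: borel_measurable_diff c simp: measurable_component_singleton cong: measurable_cong_sets)
  qed
  have fT: "(\<lambda>x. f (?T x)) \<in> borel_measurable (PiM I (\<lambda>_. lborel))"
    using measurable_compose[OF T f] .
  have "(\<integral>\<^sup>+x. f (?T x) \<partial>PiM I (\<lambda>_. lborel))
     = (\<integral>\<^sup>+x. (\<integral>\<^sup>+y. f (?T (merge ?D J (x, y))) \<partial>PiM J (\<lambda>_. lborel)) \<partial>PiM ?D (\<lambda>_. lborel))"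
    using L.product_nn_integral_fold[OF disj fin, of "\<lambda>x. f (?T x)", unfolded IJ, OF fT] .
  also have "\<dots> = (\<integral>\<^sup>+x. (\<integral>\<^sup>+y. f (merge ?D J (x, y)) \<partial>PiM J (\<lambda>_. lborel)) \<partial>PiM ?D (\<lambda>_. lborel))"
  proof (rule nn_integral_cong)
    fix x assume x: "x \<in> space (PiM ?D (\<lambda>_. lborel :: real measure))"
    let ?R = "\<lambda>y. \<lambda>k\<in>J. c k x - y k"
    have T_merge: "?T (merge ?D J (x, y)) = merge ?D J (x, ?R y)" for y
    proof -
      have "c k (merge ?D J (x, y)) = c k x" if "k \<in> J" for k
        by (rule indep[OF that]) (auto simp: merge_def)
      then show ?thesis
        using assms(2) x by (auto simp: merge_def fun_eq_iff)
    qed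
    have g: "(\<lambda>y. f (merge ?D J (x, y))) \<in> borel_measurable (PiM J (\<lambda>_. lborel))"
    proof -
      have "(\<lambda>y. merge ?D J (x, y)) \<in> measurable (PiM J (\<lambda>_. lborel)) (PiM (?D \<union> J) (\<lambda>_. lborel))"
        by (rule measurable_compose[OF measurable_Pair1'[OF x] measurable_merge])
      from measurable_compose[OF this[unfolded IJ] f] show ?thesis .
    qed
    have R: "?R \<in> measurable (PiM J (\<lambda>_. lborel)) (PiM J (\<lambda>_. lborel :: real measure))"
      by (intro measurable_restrict) simp
    have "(\<integral>\<^sup>+y. f (?T (merge ?D J (x, y))) \<partial>PiM J (\<lambda>_. lborel))
        = (\<integral>\<^sup>+y. f (merge ?D J (x, y)) \<partial>distr (PiM J (\<lambda>_. lborel)) (PiM J (\<lambda>_. lborel)) ?R)"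
      unfolding T_merge by (subst nn_integral_distr[OF R]) (use g in auto)
    then show "(\<integral>\<^sup>+y. f (?T (merge ?D J (x, y))) \<partial>PiM J (\<lambda>_. lborel))
        = (\<integral>\<^sup>+y. f (merge ?D J (x, y)) \<partial>PiM J (\<lambda>_. lborel))"
      by (simp add: PiM_lborel_reflect[OF fin(2)])
  qed
  also have "\<dots> = (\<integral>\<^sup>+x. f x \<partial>PiM I (\<lambda>_. lborel))"
    using L.product_nn_integral_fold[OF disj fin, of f, unfolded IJ, OF f] by simp
  finally show ?thesis .
qed

section \<open>The Birkhoff polytope in block coordinates\<close>

text \<open>Keeps the lower index bound \<open>1\<close> from becoming \<open>Suc 0\<close>, so that
  facts about \<open>{1..n}\<close> and \<open>{1..<n}\<close> keep matching.\<close>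

declare One_nat_def [simp del]

definition row_completion :: "nat \<Rightarrow> (nat \<times> nat \<Rightarrow> real) \<Rightarrow> nat \<Rightarrow> nat \<Rightarrow> real" where
  "row_completion n x i j = (if j < n then x (i, j) else 1 - (\<Sum>k\<in>{1..<n}. x (i, k)))"

text \<open>The affine inverse of \<open>block\<close>: the last column is filled from the row sums,
  then the last row from the column sums. Entries may be negative; the polytope is where they are
  not.\<close>

definition ds_completion :: "nat \<Rightarrow> (nat \<times> nat \<Rightarrow> real) \<Rightarrow> nat \<Rightarrow> nat \<Rightarrow> real" where
  "ds_completion n x i j =
    (if i < n then row_completion n x i j else 1 - (\<Sum>k\<in>{1..<n}. row_completion n x k j))"

lemma sum_upto_last:
  fixes f :: "nat \<Rightarrow> real"
  assumes "n \<ge> 1"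
  shows "(\<Sum>i=1..n. f i) = (\<Sum>i\<in>{1..<n}. f i) + f n"
proof -
  have "{1..n} = insert n {1..<n}" using assms by auto
  then show ?thesis by simp
qed

lemma row_completion_sum: "n \<ge> 1 \<Longrightarrow> (\<Sum>j=1..n. row_completion n x i j) = 1"
  by (simp add: sum_upto_last row_completion_def)

lemma completion_col_sum: "n \<ge> 1 \<Longrightarrow> (\<Sum>i=1..n. ds_completion n x i j) = 1"
  by (simp add: sum_upto_last ds_completion_def)

text \<open>Only the last row is not immediate from the construction. Its sum is the total over the
  \<open>n\<close> columns, each of sum \<open>1\<close>, minus the total over the
  \<open>n - 1\<close> other rows.\<close>

lemma completion_row_sum:
  assumes "n \<ge> 1"
  shows "(\<Sum>j=1..n. ds_completion n x i j) = 1"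
proof (cases "i < n")
  case True
  then show ?thesis
    using assms by (simp add: ds_completion_def row_completion_sum)
next
  case False
  then have "(\<Sum>j=1..n. ds_completion n x i j) = real n - (\<Sum>j=1..n. \<Sum>k\<in>{1..<n}. row_completion n x k j)"
    by (simp add: ds_completion_def sum_subtractf)
  also have "(\<Sum>j=1..n. \<Sum>k\<in>{1..<n}. row_completion n x k j) = real (n - 1)"
    using assms by (subst sum.swap) (simp add: row_completion_sum)
  finally show ?thesis
    using assms by simp
qed

lemma completion_last_row:
  "n \<ge> 1 \<Longrightarrow> ds_completion n x n j = 1 - (\<Sum>k\<in>{1..<n}. ds_completion n x k j)"
  using completion_col_sum[of n x j] by (simp add: sum_upto_last)

lemma completion_last_col:
  "n \<ge> 1 \<Longrightarrow> ds_completion n x i n = 1 - (\<Sum>k\<in>{1..<n}. ds_completion n x i k)"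
  using completion_row_sum[of n x i] by (simp add: sum_upto_last)

lemma completion_interior: "i < n \<Longrightarrow> j < n \<Longrightarrow> ds_completion n x i j = x (i, j)"
  by (simp add: ds_completion_def row_completion_def)

text \<open>A block and the line sums determine the matrix; the sum of row \<open>n\<close> is
  absent from the hypotheses because the columns already fix that row. This uniqueness identifies
  the completions of convex combinations and of row exchanges.\<close>

lemma completion_eqI:
  assumes "n \<ge> 1"
    and "\<And>i j. i \<in> {1..<n} \<Longrightarrow> j \<in> {1..<n} \<Longrightarrow> ds_completion n x i j = A i j"
    and rows: "\<And>i. i \<in> {1..<n} \<Longrightarrow> (\<Sum>j=1..n. A i j) = 1"
    and cols: "\<And>j. j \<in> {1..n} \<Longrightarrow> (\<Sum>i=1..n. A i j) = 1"
    and ij: "i \<in> {1..n}" "j \<in> {1..n}"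
  shows "ds_completion n x i j = A i j"
proof -
  have upper: "ds_completion n x i j = A i j" if "i \<in> {1..<n}" "j \<in> {1..n}" for i j
  proof (cases "j = n")
    case True
    have "A i n = 1 - (\<Sum>k\<in>{1..<n}. A i k)"
      using rows[OF that(1)] \<open>n \<ge> 1\<close> by (simp add: sum_upto_last)
    then show ?thesis
      using True that assms(1,2) by (simp add: completion_last_col)
  qed (use that assms(2) in auto)
  show ?thesis
  proof (cases "i = n")
    case True
    have "A n j = 1 - (\<Sum>k\<in>{1..<n}. A k j)"
      using cols[OF ij(2)] \<open>n \<ge> 1\<close> by (simp add: sum_upto_last)
    then show ?thesis
      using True upper ij assms(1) by (simp add: completion_last_row)
  qed (use ij upper in auto)
qed

lemma completion_block:
  assumes "doubly_stochastic n A" "i \<in> {1..n}" "j \<in> {1..n}"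
  shows "ds_completion n (block n A) i j = A i j"
proof (rule completion_eqI)
  show "n \<ge> 1" using assms by auto
qed (use assms in \<open>auto simp: doubly_stochastic_def completion_interior block_def\<close>)

lemma block_completion: "x \<in> extensional (block_index n) \<Longrightarrow> block n (ds_completion n x) = x"
  by (auto simp: block_def fun_eq_iff completion_interior extensional_def restrict_def)

lemma space_block_lebesgue: "space (block_lebesgue n) = extensional (block_index n)"
  by (auto simp: block_lebesgue_def space_PiM PiE_def)

text \<open>Replaces the image under \<open>block\<close> by finitely many affine inequalities, from
  which measurability and convexity can be read off.\<close>

lemma birkhoff_blocks_eq:
  assumes "n \<ge> 1"
  shows "birkhoff_blocks n =
    {x \<in> space (block_lebesgue n). \<forall>i\<in>{1..n}. \<forall>j\<in>{1..n}. 0 \<le> ds_completion n x i j}" (is "_ = ?K")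
proof (intro set_eqI iffI)
  fix x assume "x \<in> birkhoff_blocks n"
  then obtain A where "doubly_stochastic n A" "x = block n A"
    by (auto simp: birkhoff_blocks_def)
  then show "x \<in> ?K"
    by (auto simp: completion_block space_block_lebesgue)
      (auto simp: doubly_stochastic_def block_def)
next
  fix x assume x: "x \<in> ?K"
  then have "doubly_stochastic n (ds_completion n x)"
    using assms by (simp add: doubly_stochastic_def completion_row_sum completion_col_sum del: atLeastAtMost_iff)
  then show "x \<in> birkhoff_blocks n"
    using x block_completion[of x n] by (force simp: birkhoff_blocks_def space_block_lebesgue)
qed

lemma completion_measurable [measurable]:
  assumes "i \<in> {1..n}" "j \<in> {1..n}"
  shows "(\<lambda>x. ds_completion n x i j) \<in> borel_measurable (block_lebesgue n)"
proof -
  have 1: "(\<lambda>x. x (i, j)) \<in> borel_measurable (block_lebesgue n)"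
    if "i \<in> {1..<n}" "j \<in> {1..<n}" for i j
    using that unfolding block_lebesgue_def
    by (intro measurable_component_singleton[THEN measurable_compose]) auto
  have 2: "(\<lambda>x. row_completion n x i j) \<in> borel_measurable (block_lebesgue n)"
    if "i \<in> {1..<n}" "j \<in> {1..n}" for i j
    using that unfolding row_completion_def
    by (cases "j < n") (auto intro!: 1 borel_measurable_sum borel_measurable_diff)
  show ?thesis
    using assms unfolding ds_completion_def
    by (cases "i < n") (auto intro!: 2 borel_measurable_sum borel_measurable_diff)
qed

lemma birkhoff_blocks_measurable [measurable]:
  "n \<ge> 1 \<Longrightarrow> birkhoff_blocks n \<in> sets (block_lebesgue n)"
  unfolding birkhoff_blocks_eq by measurable

section \<open>Convexity of the polytope and log-concavity of its tail volumes\<close>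

lemma completion_convex_combination:
  assumes "n \<ge> 1" "i \<in> {1..n}" "j \<in> {1..n}"
  shows "ds_completion n (\<lambda>k\<in>block_index n. (1 - l) * x k + l * y k) i j =
    (1 - l) * ds_completion n x i j + l * ds_completion n y i j"
proof (rule completion_eqI)
  show "n \<ge> 1" by fact
qed (use assms in \<open>simp_all add: completion_interior sum.distrib completion_row_sum completion_col_sum
  flip: sum_distrib_left\<close>)

lemma birkhoff_blocks_convex:
  assumes "n \<ge> 1" "0 \<le> l" "l \<le> 1" "x \<in> birkhoff_blocks n" "y \<in> birkhoff_blocks n"
  shows "(\<lambda>k\<in>block_index n. (1 - l) * x k + l * y k) \<in> birkhoff_blocks n"
  using assms
  by (auto simp: birkhoff_blocks_eq completion_convex_combination space_block_lebesgue)

lemma birkhoff_blocks_subset_cube: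
  assumes "n \<ge> 1"
  shows "birkhoff_blocks n \<subseteq> PiE (block_index n) (\<lambda>_. {0..1})"
proof
  fix x assume x: "x \<in> birkhoff_blocks n"
  then have nonneg: "0 \<le> ds_completion n x i j" if "i \<in> {1..n}" "j \<in> {1..n}" for i j
    using assms that by (simp add: birkhoff_blocks_eq)
  have le1: "ds_completion n x i j \<le> 1" if "i \<in> {1..n}" "j \<in> {1..n}" for i j
    using member_le_sum[of j "{1..n}" "ds_completion n x i"] nonneg that
    by (simp add: completion_row_sum[OF assms])
  show "x \<in> PiE (block_index n) (\<lambda>_. {0..1})"
  proof (rule PiE_I)
    fix k assume k: "k \<in> block_index n"
    then have "x k = ds_completion n x (fst k) (snd k)"
      by (auto simp: completion_interior)
    then show "x k \<in> {0..1}"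
      using k nonneg[of "fst k" "snd k"] le1[of "fst k" "snd k"] by auto
  next
    fix k assume "k \<notin> block_index n"
    then show "x k = undefined"
      using x assms extensional_arb[of x "block_index n" k]
      by (simp add: birkhoff_blocks_eq space_block_lebesgue)
  qed
qed

text \<open>A point of the whole polytope, with weight \<open>1 - l\<close>, contributes a
  nonnegative amount to the entry; a point of the tail at \<open>t\<close>, with weight
  \<open>l\<close>, contributes more than \<open>l * t\<close>. The whole polytope thus plays the
  part of level \<open>0\<close>.\<close>

lemma birkhoff_tail_log_concave:
  fixes t l :: real
  assumes n: "n \<ge> 1" and l: "0 < l" "l < 1" and ij: "i \<in> {1..n}" "j \<in> {1..n}"
  defines "V \<equiv> \<lambda>t. measure (block_lebesgue n) {x \<in> birkhoff_blocks n. ds_completion n x i j > t}"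
  shows "measure (block_lebesgue n) (birkhoff_blocks n) powr (1 - l) * V t powr l \<le> V (l * t)"
proof -
  have [measurable]: "{x \<in> birkhoff_blocks n. ds_completion n x i j > t} \<in> sets (block_lebesgue n)" for t
  proof -
    have "{x \<in> birkhoff_blocks n. ds_completion n x i j > t}
        = birkhoff_blocks n \<inter> {x \<in> space (block_lebesgue n). ds_completion n x i j > t}"
      using n by (auto simp: birkhoff_blocks_eq)
    then show ?thesis using n ij by simp
  qed
  have "(\<lambda>k\<in>block_index n. (1 - l) * x k + l * y k) \<in> {x \<in> birkhoff_blocks n. ds_completion n x i j > l * t}"
    if "x \<in> birkhoff_blocks n" "y \<in> {x \<in> birkhoff_blocks n. ds_completion n x i j > t}" for x y
  proof -
    have "0 \<le> (1 - l) * ds_completion n x i j"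
      using that l ij n by (auto simp: birkhoff_blocks_eq)
    moreover have "l * t < l * ds_completion n y i j"
      using that l by simp
    ultimately have "l * t < (1 - l) * ds_completion n x i j + l * ds_completion n y i j"
      by linarith
    then show ?thesis
      using that n l ij by (auto simp: completion_convex_combination intro!: birkhoff_blocks_convex)
  qed
  note combination = this
  have sub: "{x \<in> birkhoff_blocks n. ds_completion n x i j > t} \<subseteq> PiE (block_index n) (\<lambda>_. {0..1})" for t
    using birkhoff_blocks_subset_cube[OF n] by blast
  show ?thesis
    unfolding V_def
    by (rule brunn_minkowski_cube[of "block_index n", folded block_lebesgue_def])
      (simp, fact l, fact l, rule birkhoff_blocks_measurable[OF n], fact, fact,
        rule birkhoff_blocks_subset_cube[OF n], rule sub, rule sub, rule combination)
qed

text \<open>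
  In block coordinates, exchanging rows \<open>m\<close> and \<open>n\<close> replaces \<open>x (m, j)\<close> by a function of the other
  rows minus \<open>x (m, j)\<close>, so it is a shear composed with a reflection and preserves volume.
\<close>

definition swap_last_row :: "nat \<Rightarrow> nat \<Rightarrow> (nat \<times> nat \<Rightarrow> real) \<Rightarrow> nat \<times> nat \<Rightarrow> real" where
  "swap_last_row n m x = block n (\<lambda>i. ds_completion n x (Transposition.transpose m n i))"

lemma completion_swap_last_row:
  assumes "n \<ge> 1" "m \<in> {1..n}" "i \<in> {1..n}" "j \<in> {1..n}"
  shows "ds_completion n (swap_last_row n m x) i j = ds_completion n x (Transposition.transpose m n i) j"
proof (rule completion_eqI)
  have "bij_betw (Transposition.transpose m n) {1..n} {1..n}"
    using assms by (auto intro!: permutes_imp_bij permutes_swap_id)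
  then show "(\<Sum>i=1..n. ds_completion n x (Transposition.transpose m n i) j) = 1" for j
    using sum.reindex_bij_betw[of "Transposition.transpose m n" "{1..n}" "{1..n}" "\<lambda>i. ds_completion n x i j"] assms(1)
    by (simp add: completion_col_sum)
qed (use assms in \<open>auto simp: completion_interior completion_row_sum swap_last_row_def block_def\<close>)

text \<open>The right side lists inequalities instead of saying that \<open>x\<close> is in the
  polytope, because \<open>x\<close> is arbitrary: the exchanged block is extensional even if
  \<open>x\<close> is not.\<close>

lemma swap_last_row_birkhoff_blocks:
  assumes "n \<ge> 1" "m \<in> {1..n}"
  shows "swap_last_row n m x \<in> birkhoff_blocks n \<longleftrightarrow>
    (\<forall>i\<in>{1..n}. \<forall>j\<in>{1..n}. 0 \<le> ds_completion n x i j)"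
proof -
  have img: "Transposition.transpose m n ` {1..n} = {1..n}"
    using assms by (intro permutes_image permutes_swap_id) auto
  have "swap_last_row n m x \<in> birkhoff_blocks n \<longleftrightarrow>
      (\<forall>i\<in>{1..n}. \<forall>j\<in>{1..n}. 0 \<le> ds_completion n x (Transposition.transpose m n i) j)"
    using assms
    by (simp add: birkhoff_blocks_eq completion_swap_last_row space_block_lebesgue del: atLeastAtMost_iff)
      (simp add: swap_last_row_def block_def)
  also have "\<dots> \<longleftrightarrow> (\<forall>i\<in>Transposition.transpose m n ` {1..n}. \<forall>j\<in>{1..n}. 0 \<le> ds_completion n x i j)"
    by blast
  finally show ?thesis
    unfolding img .
qed

lemma nn_integral_swap_last_row:
  assumes n: "n \<ge> 1" and m: "m \<in> {1..<n}"
    and f: "f \<in> borel_measurable (block_lebesgue n)"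
  shows "(\<integral>\<^sup>+x. f (swap_last_row n m x) \<partial>block_lebesgue n) = (\<integral>\<^sup>+x. f x \<partial>block_lebesgue n)"
proof -
  let ?J = "{m} \<times> {1..<n}"
  let ?c = "\<lambda>k x. 1 - (\<Sum>i\<in>{1..<n} - {m}. x (i, snd k))"
  have eq: "swap_last_row n m x = (\<lambda>k\<in>block_index n. if k \<in> ?J then ?c k x - x k else x k)" for x
  proof
    fix k :: "nat \<times> nat"
    obtain i j where k: "k = (i, j)" by force
    show "swap_last_row n m x k = (\<lambda>k\<in>block_index n. if k \<in> ?J then ?c k x - x k else x k) k"
    proof (cases "k \<in> ?J")
      case True
      then have "swap_last_row n m x k = ds_completion n x n j"
        using m by (auto simp: k swap_last_row_def block_def)
      also have "\<dots> = 1 - (\<Sum>i\<in>{1..<n}. x (i, j))"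
        using n True by (simp add: completion_last_row completion_interior k)
      also have "\<dots> = ?c k x - x k"
        using m True by (subst sum.remove[of _ m]) (auto simp: k)
      finally show ?thesis using True m by auto
    qed (auto simp: k swap_last_row_def block_def completion_interior transpose_def)
  qed
  show ?thesis
    unfolding eq block_lebesgue_def
  proof (rule nn_integral_PiM_lborel_shear_reflect)
    show "?c k \<in> borel_measurable (PiM (block_index n) (\<lambda>_. lborel))" if "k \<in> ?J" for k
      using that
      by (intro borel_measurable_diff borel_measurable_const borel_measurable_sum
          measurable_component_singleton[THEN measurable_compose]) auto
    show "f \<in> borel_measurable (PiM (block_index n) (\<lambda>_. lborel))"
      using f by (simp add: block_lebesgue_def)
    show "?c k x = ?c k y" if "k \<in> ?J" "\<And>i. i \<in> block_index n - ?J \<Longrightarrow> x i = y i" for k and x y :: "nat \<times> nat \<Rightarrow> real"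
    proof -
      have "(\<Sum>i\<in>{1..<n} - {m}. x (i, snd k)) = (\<Sum>i\<in>{1..<n} - {m}. y (i, snd k))"
        using that by (intro sum.cong) auto
      then show ?thesis by simp
    qed
  qed (use m in auto)
qed

text \<open>The volume-preserving exchange maps the polytope to itself and carries row
  \<open>m\<close> to row \<open>n\<close>. Comparing every row with the last one suffices to
  compare any two.\<close>

lemma nn_integral_birkhoff_row:
  assumes n: "n \<ge> 1" and m: "m \<in> {1..n}" and j: "j \<in> {1..n}"
  shows "(\<integral>\<^sup>+x. ennreal (ds_completion n x m j) * indicator (birkhoff_blocks n) x \<partial>block_lebesgue n)
    = (\<integral>\<^sup>+x. ennreal (ds_completion n x n j) * indicator (birkhoff_blocks n) x \<partial>block_lebesgue n)"
proof (cases "m = n")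
  case False
  then have m': "m \<in> {1..<n}" using m by auto
  let ?f = "\<lambda>x. ennreal (ds_completion n x m j) * indicator (birkhoff_blocks n) x"
  have "?f \<in> borel_measurable (block_lebesgue n)"
    using n m j by measurable
  then have "(\<integral>\<^sup>+x. ?f x \<partial>block_lebesgue n) = (\<integral>\<^sup>+x. ?f (swap_last_row n m x) \<partial>block_lebesgue n)"
    by (rule nn_integral_swap_last_row[OF n m', symmetric])
  also have "\<dots> = (\<integral>\<^sup>+x. ennreal (ds_completion n x n j) * indicator (birkhoff_blocks n) x \<partial>block_lebesgue n)"
  proof (rule nn_integral_cong)
    fix x assume "x \<in> space (block_lebesgue n)"
    then have "indicator (birkhoff_blocks n) (swap_last_row n m x) = (indicator (birkhoff_blocks n) x :: ennreal)"
      unfolding indicator_def swap_last_row_birkhoff_blocks[OF n m] by (simp add: birkhoff_blocks_eq[OF n])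
    then show "?f (swap_last_row n m x) = ennreal (ds_completion n x n j) * indicator (birkhoff_blocks n) x"
      using n m j by (simp add: completion_swap_last_row)
  qed
  finally show ?thesis .
qed simp

section \<open>Tails of the entries\<close>

lemma integral_unit_uniform_exp:
  fixes a :: real
  assumes "a > 0"
  shows "(\<integral>s. exp (- (a * s)) \<partial>unit_uniform) = (1 - exp (- a)) / a"
proof -
  have dens: "unit_uniform = density lborel (\<lambda>x. ennreal (indicator {0..1} x))"
    by (simp add: unit_uniform_def uniform_measure_def divide_ennreal_def ennreal_indicator)
  have "(\<integral>s. exp (- (a * s)) \<partial>unit_uniform)
      = (\<integral>s. indicator {0..1} s *\<^sub>R exp (- (a * s)) \<partial>lborel)"
    unfolding dens by (rule integral_density) auto
  also have "\<dots> = (- exp (- (a * 1)) / a) - (- exp (- (a * 0)) / a)"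
    using assms
    by (intro integral_FTC_Icc[where F="\<lambda>s. - exp (- (a * s)) / a"])
      (auto intro!: derivative_eq_intros continuous_intros simp: has_real_derivative_iff_has_vector_derivative[symmetric])
  finally show ?thesis
    by (simp add: diff_divide_distrib)
qed

text \<open>Writing the tail at \<open>t\<close> as \<open>exp (- a)\<close>, the tail at
  \<open>s * t\<close> is at least \<open>exp (- (a * s))\<close>. Integrating over \<open>s\<close>
  bounds the mean from below in terms of \<open>a\<close>, so a small mean forces a large
  \<open>a\<close>.\<close>

lemma (in prob_space) log_concave_tail_bound:
  fixes Y :: "'a \<Rightarrow> real"
  assumes Y: "integrable M Y" and nonneg: "AE \<omega> in M. 0 \<le> Y \<omega>"
    and mean: "expectation Y > 0" and "t > 0"
    and log_concave: "\<And>l. 0 < l \<Longrightarrow> l < 1 \<Longrightarrow>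
      prob {\<omega> \<in> space M. t < Y \<omega>} powr l \<le> prob {\<omega> \<in> space M. l * t < Y \<omega>}"
  shows "prob {\<omega> \<in> space M. t < Y \<omega>} \<le> exp (1 - t / expectation Y)"
proof -
  have [measurable]: "Y \<in> borel_measurable M" using Y by auto
  define p where "p = prob {\<omega> \<in> space M. t < Y \<omega>}"
  define a where "a = - ln p"
  show ?thesis
  proof (cases "p = 0")
    case False
    then have p: "0 < p" "p \<le> 1"
      by (simp_all add: p_def zero_less_measure_iff)
    then have a: "0 \<le> a" "p = exp (- a)"
      by (simp_all add: a_def)
    \<comment> \<open>\<open>Y\<close> is nonnegative only almost everywhere, whereas
      \<open>layer_cake\<close> asks for it everywhere. Cutting at \<open>0\<close> does not change
      the tails at positive levels.\<close>
    let ?Z = "\<lambda>\<omega>. max 0 (Y \<omega> / t)"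
    have "(\<integral>s. exp (- (a * s)) \<partial>unit_uniform) \<le> (\<integral>s. prob {\<omega> \<in> space M. s < ?Z \<omega>} \<partial>unit_uniform)"
    proof (rule integral_mono_AE)
      show "integrable unit_uniform (\<lambda>s. exp (- (a * s)))"
        using AE_unit_uniform a
        by (intro unit_uniform.integrable_const_bound[where B=1]) (auto elim!: eventually_mono)
      show "integrable unit_uniform (\<lambda>s. prob {\<omega> \<in> space M. s < ?Z \<omega>})"
        by (intro unit_uniform.integrable_const_bound[where B=1]) measurable
      show "AE s in unit_uniform. exp (- (a * s)) \<le> prob {\<omega> \<in> space M. s < ?Z \<omega>}"
        using AE_unit_uniform
      proof eventually_elim
        case (elim s)
        have "exp (- (a * s)) = p powr s"
          using p by (simp add: a_def powr_def mult.commute)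
        also have "\<dots> \<le> prob {\<omega> \<in> space M. s * t < Y \<omega>}"
          unfolding p_def using elim by (intro log_concave) auto
        also have "{\<omega> \<in> space M. s * t < Y \<omega>} = {\<omega> \<in> space M. s < ?Z \<omega>}"
        proof -
          have "0 \<le> Y \<omega>" if "s * t < Y \<omega>" for \<omega>
            using that mult_pos_pos[of s t] elim \<open>t > 0\<close> by linarith
          then show ?thesis
            using elim \<open>t > 0\<close> by (auto simp: pos_less_divide_eq max_def)
        qed
        finally show ?case .
      qed
    qed
    also have "\<dots> = expectation (\<lambda>\<omega>. min (?Z \<omega>) 1)"
      by (rule layer_cake) auto
    also have "\<dots> \<le> expectation (\<lambda>\<omega>. Y \<omega> / t)"
    proof (rule integral_mono_AE)
      show "AE \<omega> in M. min (?Z \<omega>) 1 \<le> Y \<omega> / t"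
        using nonneg by eventually_elim (use \<open>t > 0\<close> in auto)
      show "integrable M (\<lambda>\<omega>. min (?Z \<omega>) 1)"
        by (rule integrable_const_bound[where B=1]) auto
    qed (use Y in auto)
    finally have le: "(\<integral>s. exp (- (a * s)) \<partial>unit_uniform) \<le> expectation Y / t"
      by simp
    \<comment> \<open>This simpler lower bound, from \<open>1 + a \<le> exp a\<close>, makes the
      inequality solvable for \<open>a\<close>; it is the source of the \<open>1\<close> in the
      final exponent. At \<open>a = 0\<close> both sides are \<open>1\<close>.\<close>
    have "1 / (1 + a) \<le> (\<integral>s. exp (- (a * s)) \<partial>unit_uniform)"
    proof (cases "a = 0")
      case False
      then have "a > 0" using a by simp
      have "(1 + a) * exp (- a) \<le> exp a * exp (- a)"
        by (intro mult_right_mono exp_ge_add_one_self) auto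
      also have "\<dots> = 1" by (simp flip: exp_add)
      finally have "a \<le> (1 + a) * (1 - exp (- a))"
        by (simp add: algebra_simps)
      then show ?thesis
        unfolding integral_unit_uniform_exp[OF \<open>a > 0\<close>] using \<open>a > 0\<close> by (simp add: field_simps)
    qed (simp add: unit_uniform.prob_space[simplified])
    also note le
    finally have "t / expectation Y \<le> 1 + a"
      using \<open>t > 0\<close> mean a by (simp add: field_simps)
    then show ?thesis
      using a by (simp add: p_def)
  qed (simp add: p_def)
qed

text \<open>In \<open>ennreal\<close> both \<open>0 / 0\<close> and
  \<open>\<infinity> / \<infinity>\<close> are \<open>0\<close>, so total mass \<open>1\<close>
  excludes these two volumes. The polytope thus gets positive finite volume from the law of
  \<open>X\<close>, without any computation.\<close>

lemma prob_space_uniform_measureD: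
  assumes "prob_space (uniform_measure M A)" "A \<in> sets M"
  shows "emeasure M A \<noteq> 0" "emeasure M A \<noteq> \<infinity>"
proof -
  interpret prob_space "uniform_measure M A" by fact
  have "emeasure M A / emeasure M A = 1"
    using emeasure_space_1 assms(2) sets.sets_into_space[OF assms(2)] by (simp add: Int_absorb2)
  then show "emeasure M A \<noteq> 0" "emeasure M A \<noteq> \<infinity>"
    by (auto simp: divide_ennreal_def)
qed

section \<open>Law, mean and tail of the entries of a uniform matrix\<close>

context
  fixes M :: "'a measure" and n :: nat and X :: "'a \<Rightarrow> nat \<Rightarrow> nat \<Rightarrow> real"
  assumes unif: "uniform_doubly_stochastic M n X" and n: "n \<ge> 1"
begin

interpretation M: prob_space M
  using unif by (simp add: uniform_doubly_stochastic_def)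

lemma entry_measurable: "i \<in> {1..n} \<Longrightarrow> j \<in> {1..n} \<Longrightarrow> (\<lambda>\<omega>. X \<omega> i j) \<in> borel_measurable M"
  using unif by (simp add: uniform_doubly_stochastic_def)

lemma AE_doubly_stochastic: "AE \<omega> in M. doubly_stochastic n (X \<omega>)"
  using unif by (simp add: uniform_doubly_stochastic_def)

lemma block_measurable: "(\<lambda>\<omega>. block n (X \<omega>)) \<in> measurable M (block_lebesgue n)"
proof -
  have "(\<lambda>\<omega>. block n (X \<omega>)) = (\<lambda>\<omega>. \<lambda>k\<in>block_index n. X \<omega> (fst k) (snd k))"
    by (auto simp: block_def fun_eq_iff)
  then show ?thesis
    unfolding block_lebesgue_def
    by (auto intro!: measurable_restrict entry_measurable)
qed

lemma distr_block:
  "distr M (block_lebesgue n) (\<lambda>\<omega>. block n (X \<omega>)) = uniform_measure (block_lebesgue n) (birkhoff_blocks n)"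
  using unif by (simp add: uniform_doubly_stochastic_def)

lemma birkhoff_volume:
  "emeasure (block_lebesgue n) (birkhoff_blocks n) \<noteq> 0"
  "emeasure (block_lebesgue n) (birkhoff_blocks n) \<noteq> \<infinity>"
  using prob_space_uniform_measureD[OF _ birkhoff_blocks_measurable[OF n]] M.prob_space_distr[OF block_measurable]
  by (simp_all add: distr_block)

lemma entry_completion:
  assumes "i \<in> {1..n}" "j \<in> {1..n}"
  shows "AE \<omega> in M. X \<omega> i j = ds_completion n (block n (X \<omega>)) i j"
  using AE_doubly_stochastic by eventually_elim (use assms in \<open>simp add: completion_block\<close>)

lemma prob_entry_greater:
  assumes ij: "i \<in> {1..n}" "j \<in> {1..n}"
  shows "M.prob {\<omega> \<in> space M. t < X \<omega> i j} =
    measure (block_lebesgue n) {x \<in> birkhoff_blocks n. t < ds_completion n x i j} /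
    measure (block_lebesgue n) (birkhoff_blocks n)"
proof -
  note [measurable] = block_measurable completion_measurable[OF ij] entry_measurable[OF ij]
  have "M.prob {\<omega> \<in> space M. t < X \<omega> i j}
      = M.prob {\<omega> \<in> space M. t < ds_completion n (block n (X \<omega>)) i j}"
    by (rule M.finite_measure_eq_AE) (use entry_completion[OF ij] in \<open>auto elim!: eventually_mono\<close>)
  also have "\<dots> = measure (distr M (block_lebesgue n) (\<lambda>\<omega>. block n (X \<omega>)))
      {x \<in> space (block_lebesgue n). t < ds_completion n x i j}"
    by (subst measure_distr)
      (auto intro!: arg_cong[where f="measure M"] measurable_space[OF block_measurable])
  also have "\<dots> = measure (block_lebesgue n) (birkhoff_blocks n \<inter> {x \<in> space (block_lebesgue n). t < ds_completion n x i j}) /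
      measure (block_lebesgue n) (birkhoff_blocks n)"
    unfolding distr_block using birkhoff_volume by (subst measure_uniform_measure) auto
  also have "birkhoff_blocks n \<inter> {x \<in> space (block_lebesgue n). t < ds_completion n x i j}
      = {x \<in> birkhoff_blocks n. t < ds_completion n x i j}"
    using n by (auto simp: birkhoff_blocks_eq)
  finally show ?thesis .
qed

lemma AE_entry_unit:
  assumes ij: "i \<in> {1..n}" "j \<in> {1..n}"
  shows "AE \<omega> in M. X \<omega> i j \<in> {0..1}"
  using AE_doubly_stochastic
proof eventually_elim
  case (elim \<omega>)
  then have "X \<omega> i j \<le> (\<Sum>j=1..n. X \<omega> i j)"
    using ij by (intro member_le_sum) (auto simp: doubly_stochastic_def)
  then show ?case
    using elim ij by (auto simp: doubly_stochastic_def)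
qed

lemma integrable_entry: "i \<in> {1..n} \<Longrightarrow> j \<in> {1..n} \<Longrightarrow> integrable M (\<lambda>\<omega>. X \<omega> i j)"
  using AE_entry_unit[of i j] entry_measurable[of i j]
  by (intro M.integrable_const_bound[where B=1]) (auto elim!: eventually_elim2)

text \<open>The row exchange is available for nonnegative integrals over the polytope, so the
  expectation is transported there through the law of the block and brought back by almost sure
  nonnegativity.\<close>

lemma expectation_entry_last_row:
  assumes ij: "i \<in> {1..n}" "j \<in> {1..n}"
  shows "M.expectation (\<lambda>\<omega>. X \<omega> i j) = M.expectation (\<lambda>\<omega>. X \<omega> n j)"
proof -
  have nn: "(\<integral>\<^sup>+\<omega>. ennreal (X \<omega> i j) \<partial>M) =
      (\<integral>\<^sup>+x. ennreal (ds_completion n x i j) * indicator (birkhoff_blocks n) x \<partial>block_lebesgue n)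
        / emeasure (block_lebesgue n) (birkhoff_blocks n)" if ij: "i \<in> {1..n}" "j \<in> {1..n}" for i j
  proof -
    note [measurable] = block_measurable completion_measurable[OF ij] birkhoff_blocks_measurable[OF n]
    have "(\<integral>\<^sup>+\<omega>. ennreal (X \<omega> i j) \<partial>M) = (\<integral>\<^sup>+\<omega>. ennreal (ds_completion n (block n (X \<omega>)) i j) \<partial>M)"
      by (rule nn_integral_cong_AE) (use entry_completion[OF ij] in \<open>auto elim!: eventually_mono\<close>)
    also have "\<dots> = (\<integral>\<^sup>+x. ennreal (ds_completion n x i j) \<partial>distr M (block_lebesgue n) (\<lambda>\<omega>. block n (X \<omega>)))"
      by (subst nn_integral_distr) auto
    finally show ?thesis
      unfolding distr_block by (subst (asm) nn_integral_uniform_measure) auto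
  qed
  have "n \<in> {1..n}" using n by simp
  then have "(\<integral>\<^sup>+\<omega>. ennreal (X \<omega> i j) \<partial>M) = (\<integral>\<^sup>+\<omega>. ennreal (X \<omega> n j) \<partial>M)"
    using nn_integral_birkhoff_row[OF n ij] ij by (simp only: nn)
  moreover have "M.expectation (\<lambda>\<omega>. X \<omega> i j) = enn2real (\<integral>\<^sup>+\<omega>. ennreal (X \<omega> i j) \<partial>M)"
    if "i \<in> {1..n}" for i
    using AE_entry_unit[OF that ij(2)] entry_measurable[OF that ij(2)]
    by (intro integral_eq_nn_integral) (auto elim!: eventually_mono)
  ultimately show ?thesis
    using ij \<open>n \<in> {1..n}\<close> by metis
qed

lemma expectation_entry:
  assumes ij: "i \<in> {1..n}" "j \<in> {1..n}"
  shows "M.expectation (\<lambda>\<omega>. X \<omega> i j) = 1 / n"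
proof -
  have "real n * M.expectation (\<lambda>\<omega>. X \<omega> i j) = (\<Sum>k=1..n. M.expectation (\<lambda>\<omega>. X \<omega> k j))"
  proof -
    have "M.expectation (\<lambda>\<omega>. X \<omega> k j) = M.expectation (\<lambda>\<omega>. X \<omega> i j)" if "k \<in> {1..n}" for k
      using expectation_entry_last_row[OF that ij(2)] expectation_entry_last_row[OF ij] by simp
    then show ?thesis by simp
  qed
  also have "\<dots> = M.expectation (\<lambda>\<omega>. \<Sum>k=1..n. X \<omega> k j)"
    using integrable_entry ij by simp
  also have "\<dots> = M.expectation (\<lambda>\<omega>. 1)"
  proof (rule integral_cong_AE)
    show "AE \<omega> in M. (\<Sum>k=1..n. X \<omega> k j) = 1"
      using AE_doubly_stochastic by eventually_elim (use ij in \<open>simp add: doubly_stochastic_def\<close>)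
  qed (use ij entry_measurable in auto)
  finally show ?thesis
    using n by (simp add: field_simps M.prob_space)
qed

lemma entry_tail_bound:
  fixes t :: real
  assumes ij: "i \<in> {1..n}" "j \<in> {1..n}" and "t > 0"
  shows "M.prob {\<omega> \<in> space M. t < X \<omega> i j} \<le> exp (1 - n * t)"
proof -
  define v where "v = measure (block_lebesgue n) (birkhoff_blocks n)"
  have v: "v > 0"
    using birkhoff_volume by (simp add: v_def measure_def enn2real_positive_iff less_top zero_less_iff_neq_zero)
  have "M.prob {\<omega> \<in> space M. t < X \<omega> i j} \<le> exp (1 - t / M.expectation (\<lambda>\<omega>. X \<omega> i j))"
  proof (rule M.log_concave_tail_bound)
    fix l :: real assume l: "0 < l" "l < 1"
    define V where "V s = measure (block_lebesgue n) {x \<in> birkhoff_blocks n. s < ds_completion n x i j}" for s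
    have "v powr (1 - l) * V t powr l \<le> V (l * t)"
      using birkhoff_tail_log_concave[OF n l ij, of t] by (simp add: V_def v_def)
    then have "v powr (1 - l) * V t powr l / v \<le> V (l * t) / v"
      using v by (intro divide_right_mono) auto
    \<comment> \<open>Dividing by the volume turns the factor of the whole polytope into
      \<open>1\<close>, which leaves the one-sided log-concavity of the probabilities.\<close>
    also have "v powr (1 - l) * V t powr l / v = (V t / v) powr l"
      using v by (simp add: powr_divide powr_diff V_def)
    finally show "M.prob {\<omega> \<in> space M. t < X \<omega> i j} powr l \<le> M.prob {\<omega> \<in> space M. l * t < X \<omega> i j}"
      by (simp add: prob_entry_greater[OF ij] V_def v_def)
  next
    show "AE \<omega> in M. 0 \<le> X \<omega> i j"
      using AE_entry_unit[OF ij] by eventually_elim auto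
  qed (use ij n \<open>t > 0\<close> in \<open>auto simp: integrable_entry expectation_entry\<close>)
  then show ?thesis
    using ij by (simp add: expectation_entry mult.commute)
qed

lemma max_entry_tail_bound:
  assumes "t > 0"
  shows "M.prob {\<omega> \<in> space M. (MAX (i, j)\<in>{1..n} \<times> {1..n}. real n * X \<omega> i j) > t} \<le> (real n)\<^sup>2 * exp (1 - t)"
proof -
  let ?I = "{1..n} \<times> {1..n}"
  let ?E = "\<lambda>k. {\<omega> \<in> space M. t / n < X \<omega> (fst k) (snd k)}"
  have "{\<omega> \<in> space M. (MAX (i, j)\<in>?I. real n * X \<omega> i j) > t} = (\<Union>k\<in>?I. ?E k)"
  proof -
    have "(MAX (i, j)\<in>?I. real n * X \<omega> i j) > t \<longleftrightarrow> (\<exists>k\<in>?I. t / n < X \<omega> (fst k) (snd k))" for \<omega>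
      using n by (subst Max_gr_iff) (auto simp: pos_divide_less_eq mult.commute)
    then show ?thesis by blast
  qed
  also have "M.prob \<dots> \<le> (\<Sum>k\<in>?I. M.prob (?E k))"
  proof (rule M.finite_measure_subadditive_finite)
    have "?E k \<in> sets M" if "k \<in> ?I" for k
    proof -
      have [measurable]: "(\<lambda>\<omega>. X \<omega> (fst k) (snd k)) \<in> borel_measurable M"
        using that by (intro entry_measurable) auto
      show ?thesis by measurable
    qed
    then show "?E ` ?I \<subseteq> sets M" by blast
  qed simp
  also have "\<dots> \<le> (\<Sum>k\<in>?I. exp (1 - t))"
  proof (rule sum_mono)
    fix k assume "k \<in> ?I"
    then show "M.prob (?E k) \<le> exp (1 - t)"
      using entry_tail_bound[of "fst k" "snd k" "t / n"] assms n by auto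
  qed
  finally show ?thesis
    by (simp add: power2_eq_square)
qed

end

theorem theorem2:
  fixes M :: "nat \<Rightarrow> 'a measure"
    and X :: "nat \<Rightarrow> 'a \<Rightarrow> nat \<Rightarrow> nat \<Rightarrow> real"
    and \<epsilon> :: real
  assumes "\<And>n. n \<ge> 1 \<Longrightarrow> uniform_doubly_stochastic (M n) n (X n)"
    and "\<epsilon> > 0"
  shows "(\<lambda>n. measure (M n)
            {\<omega> \<in> space (M n).
               (MAX (i, j)\<in>{1..n} \<times> {1..n}. real n * X n \<omega> i j) > (2 + \<epsilon>) * ln (real n)})
         \<longlonglongrightarrow> 0"
proof (rule tendsto_sandwich[of "\<lambda>_. 0" _ _ "\<lambda>n. exp 1 * real n powr (- \<epsilon>)"])
  show "\<forall>\<^sub>F n in sequentially. measure (M n)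
            {\<omega> \<in> space (M n).
               (MAX (i, j)\<in>{1..n} \<times> {1..n}. real n * X n \<omega> i j) > (2 + \<epsilon>) * ln (real n)}
      \<le> exp 1 * real n powr (- \<epsilon>)"
    \<comment> \<open>From \<open>n = 2\<close> on the logarithm is positive, as the tail bound
      needs a positive threshold.\<close>
    using eventually_ge_at_top[of 2]
  proof eventually_elim
    case (elim n)
    have "measure (M n) {\<omega> \<in> space (M n).
               (MAX (i, j)\<in>{1..n} \<times> {1..n}. real n * X n \<omega> i j) > (2 + \<epsilon>) * ln (real n)}
        \<le> (real n)\<^sup>2 * exp (1 - (2 + \<epsilon>) * ln (real n))"
      using elim assms by (intro max_entry_tail_bound) auto
    \<comment> \<open>The number of entries cancels the part \<open>2 * ln n\<close> of the
      threshold, and the remaining \<open>\<epsilon> * ln n\<close> gives the decay.\<close>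
    also have "(real n)\<^sup>2 = exp (2 * ln (real n))"
      using elim by (simp add: exp_double)
    also have "\<dots> * exp (1 - (2 + \<epsilon>) * ln (real n)) = exp 1 * real n powr (- \<epsilon>)"
      using elim by (simp add: powr_def algebra_simps flip: exp_add)
    finally show ?case .
  qed
  show "(\<lambda>n. exp 1 * real n powr (- \<epsilon>)) \<longlonglongrightarrow> 0"
    using assms(2) by (intro tendsto_mult_right_zero tendsto_neg_powr filterlim_real_sequentially) auto
qed auto

end
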